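(* Let $1<t<3/2$ and let $\mathcal D$ be a dyadic system on $\mathbb T$. For any $p,q$ with $$\left(\frac1p,\frac1q\right)\in[0,1]^2\quad\text{and}\quad\frac1q-\frac1p>2t-2,$$ the operator $\mathcal M_t^{\mathcal D}:L^p(\mathbb D)\to L^q(\mathbb D)$ is bounded.
   Context: $\mathbb D$ is the open unit disc in $\mathbb C$, $dA$ is normalized area measure on $\mathbb D$, $|E|$ denotes the $dA$-measure of $E\subseteq\mathbb D$, and $L^p(\mathbb D)$ is taken with respect to $dA$. $\mathbb T$ is the unit circle with arc length normalized so that $|\mathbb T|=1$; $|I|$ is the normalized length of an arc $I$. A dyadic system on $\mathbb T$ is a collection of arcs $\mathcal D=\bigcup_{k\ge0}\mathcal D_k$ where each $\mathcal D_k$ consists of $2^k$ disjoint arcs of length $2^{-k}$ with union $\mathbb T$, and each arc of $\mathcal D_k$ is the union of two arcs of $\mathcal D_{k+1}$. The Carleson box of an arc $I\subseteq\mathbb T$ is $Q_I:=\{z\in\mathbb D: z/|z|\in I,\ 1-|I|\le|z|<1\}$ (the single point $z=0$ is a null set and plays no role). The dyadic hypersingular maximal operator is $$\mathcal M_t^{\mathcal D}f(z):=\sup_{I\in\mathcal D,\ z\in Q_I}\frac{1}{|Q_I|^t}\int_{Q_I}|f(w)|\,dA(w).$$ Convention: $1/\infty=0$. *)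

theory Defs
  imports "HOL-Analysis.Analysis" "HOL-Probability.Essential_Supremum"
begin

definition disc_measure :: "complex measure" where
  "disc_measure = scale_measure (ennreal (1 / pi)) (lebesgue_on (ball 0 1))"

definition circle_measure :: "complex measure" where
  "circle_measure = distr (restrict_space lborel {0..<1}) borel (\<lambda>s. cis (2 * pi * s))"

text \<open>Arcs may be open, closed or half-open; the whole circle counts as an arc.\<close>

definition circle_arc :: "complex set \<Rightarrow> bool" where
  "circle_arc I \<longleftrightarrow> (\<exists>J::real set. is_interval J \<and> I = cis ` J)"

definition arc_len :: "complex set \<Rightarrow> real" where
  "arc_len I = measure circle_measure I"

definition dyadic_system :: "complex set set \<Rightarrow> bool" where
  "dyadic_system \<D> \<longleftrightarrow> (\<exists>G :: nat \<Rightarrow> complex set set.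
     \<D> = (\<Union>k. G k) \<and>
     (\<forall>k. card (G k) = 2 ^ k \<and> disjoint (G k) \<and> \<Union>(G k) = sphere 0 1 \<and>
          (\<forall>I\<in>G k. circle_arc I \<and> arc_len I = 1 / 2 ^ k) \<and>
          (\<forall>I\<in>G k. \<exists>J\<in>G (Suc k). \<exists>K\<in>G (Suc k). J \<noteq> K \<and> I = J \<union> K)))"

text \<open>Since \<open>0 / 0 = 0\<close> is not on the unit circle, the origin lies in no Carleson box.\<close>

definition carleson_box :: "complex set \<Rightarrow> complex set" where
  "carleson_box I = {z \<in> ball 0 1. z / of_real (cmod z) \<in> I \<and> 1 - arc_len I \<le> cmod z}"

text \<open>The supremum is taken in \<^typ>\<open>ennreal\<close>, so that it is \<open>0\<close> at points lying in no box.\<close>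

definition dyadic_maximal :: "real \<Rightarrow> complex set set \<Rightarrow> (complex \<Rightarrow> complex) \<Rightarrow> complex \<Rightarrow> ennreal" where
  "dyadic_maximal t \<D> f z =
     (SUP I \<in> {I \<in> \<D>. z \<in> carleson_box I}.
        (\<integral>\<^sup>+w\<in>carleson_box I. ennreal (cmod (f w)) \<partial>disc_measure)
          / ennreal (measure disc_measure (carleson_box I) powr t))"

definition ennreal_powr :: "ennreal \<Rightarrow> real \<Rightarrow> ennreal" where
  "ennreal_powr x a = (if x = \<infinity> then \<infinity> else ennreal (enn2real x powr a))"

text \<open>Only meaningful for exponents \<open>0 < p \<le> \<infinity>\<close> (in particular \<^const>\<open>ennreal_powr\<close> is used
  only with positive exponents). The function is the absolute value of the function whose norm is
  taken, and may be infinite.\<close>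

definition Lp_norm :: "'a measure \<Rightarrow> ennreal \<Rightarrow> ('a \<Rightarrow> ennreal) \<Rightarrow> ennreal" where
  "Lp_norm M p g =
     (if p = \<infinity> then esssup M g
      else ennreal_powr (\<integral>\<^sup>+x. ennreal_powr (g x) (enn2real p) \<partial>M) (1 / enn2real p))"

definition Lp_space :: "'a measure \<Rightarrow> ennreal \<Rightarrow> ('a \<Rightarrow> complex) set" where
  "Lp_space M p = {f \<in> borel_measurable M. Lp_norm M p (\<lambda>x. ennreal (cmod (f x))) < \<infinity>}"

text \<open>Boundedness of a (not necessarily linear) operator whose values are \<open>[0, \<infinity>]\<close>-valued
  functions.\<close>

definition bounded_Lp_Lq ::
  "'a measure \<Rightarrow> ennreal \<Rightarrow> ennreal \<Rightarrow> (('a \<Rightarrow> complex) \<Rightarrow> 'a \<Rightarrow> ennreal) \<Rightarrow> bool" where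
  "bounded_Lp_Lq M p q T \<longleftrightarrow> (\<exists>C::real. \<forall>f\<in>Lp_space M p.
     T f \<in> borel_measurable M \<and>
     Lp_norm M q (T f) \<le> ennreal C * Lp_norm M p (\<lambda>x. ennreal (cmod (f x))))"

end

theory Submission
  imports Defs
begin

text \<open>The strict inequality between the exponents leaves room to replace the supremum over the boxes by a
sum. The hypotheses make \<open>q\<close> finite and at least \<open>1\<close>; bound the power \<open>q\<close> of the supremum defining the
maximal function by the sum of the powers \<open>q\<close> of all its terms. A box \<open>Q\<close> then contributes
\<open>|Q| * (|Q| powr (-t) * (integral of |f| over Q)) powr q\<close> to the integral over the disc, and by
Jensen's inequality (\<open>set_nn_integral_powr_le\<close>) this is at most a constant times
\<open>|Q| powr (q * (1 - t))\<close> times the integral of \<open>|f| powr q\<close> over \<open>Q\<close>.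

Consider the boxes of the arcs of length \<open>h = 1 / 2 ^ k\<close>. Each has area at least a constant times
\<open>h\<^sup>2\<close>, because it contains a disc of radius \<open>h / 16\<close> (\<open>carleson_box_contains_ball\<close>). They are disjoint
and lie in the annulus \<open>1 - h \<le> |z| < 1\<close>, whose area is at most \<open>2 * h\<close>. Hoelder's inequality on the
annulus (\<open>set_nn_integral_powr_le_Lp_norm\<close>) bounds the integral of \<open>|f| powr q\<close> over it by a constant
times \<open>h powr (1 - q/p)\<close> times the power \<open>q\<close> of the norm of \<open>f\<close>. Altogether the generation \<open>k\<close>
contributes at most a constant times \<open>h powr (1 - q/p - q * (2 * t - 2))\<close> times that power of the norm.
The exponent of \<open>h\<close> is positive exactly when \<open>1/q - 1/p > 2 * t - 2\<close>, and then the sum over \<open>k\<close> is a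
convergent geometric series.\<close>

section \<open>Powers of extended nonnegative numbers\<close>

lemma ennreal_powr_ennreal [simp]:
  "0 \<le> r \<Longrightarrow> ennreal_powr (ennreal r) a = ennreal (r powr a)"
  by (simp add: ennreal_powr_def)

lemma ennreal_powr_top [simp]: "ennreal_powr top a = top"
  by (simp add: ennreal_powr_def)

lemma ennreal_powr_zero [simp]: "ennreal_powr 0 a = 0"
  by (simp add: ennreal_powr_def)

lemma ennreal_powr_one [simp]: "ennreal_powr x 1 = x"
  by (cases x) auto

lemma ennreal_powr_mono:
  assumes "x \<le> y" "0 \<le> a"
  shows "ennreal_powr x a \<le> ennreal_powr y a"
  using assms by (cases x; cases y) (auto intro!: powr_mono2 ennreal_leI simp: top_unique)

lemma ennreal_powr_mult:
  assumes "0 < a"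
  shows "ennreal_powr (x * y) a = ennreal_powr x a * ennreal_powr y a"
proof (cases x)
  case (real r)
  show ?thesis
  proof (cases y)
    case (real s)
    with \<open>x = ennreal r\<close> \<open>0 \<le> r\<close> show ?thesis
      by (simp add: powr_mult flip: ennreal_mult)
  next
    case top
    with real assms show ?thesis
      by (cases "r = 0") (auto simp: ennreal_mult_top)
  qed
next
  case top
  with assms show ?thesis
    by (cases y) (auto simp: ennreal_top_mult)
qed

lemma ennreal_powr_powr:
  "ennreal_powr (ennreal_powr x a) b = ennreal_powr x (a * b)"
  by (cases x) (auto simp: powr_powr)

lemma measurable_ennreal_powr [measurable]:
  "(\<lambda>x. ennreal_powr x a) \<in> borel_measurable borel"
  unfolding ennreal_powr_def by measurable

section \<open>Power means and Hoelder's inequality\<close>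

text \<open>Jensen's inequality for the power \<open>s\<close>, up to the factor \<open>2 powr s\<close>. For every level \<open>l > 0\<close> one has
\<open>u \<le> l + l powr (1 - s) * u powr s\<close>, since \<open>u powr (s - 1) \<ge> l powr (s - 1)\<close> where \<open>u > l\<close>.
Integrating over \<open>A\<close> and choosing \<open>l\<close> so that the two terms agree gives the inequality.\<close>

lemma set_nn_integral_powr_le:
  fixes u :: "'a \<Rightarrow> ennreal" and s m :: real
  assumes u [measurable]: "u \<in> borel_measurable M" and A [measurable]: "A \<in> sets M"
    and m: "emeasure M A \<le> ennreal m" "0 < m" and s: "1 \<le> s"
  shows "ennreal_powr (\<integral>\<^sup>+x\<in>A. u x \<partial>M) s
           \<le> ennreal (2 powr s * m powr (s - 1)) * (\<integral>\<^sup>+x\<in>A. ennreal_powr (u x) s \<partial>M)"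
proof -
  define B where "B = (\<integral>\<^sup>+x\<in>A. ennreal_powr (u x) s \<partial>M)"
  have pt: "u x \<le> ennreal l + ennreal (l powr (1 - s)) * ennreal_powr (u x) s" if "0 < l" for l x
  proof (cases "u x")
    case (real r)
    have "r \<le> l + l powr (1 - s) * r powr s"
    proof (cases "r \<le> l")
      case True
      then show ?thesis by (simp add: add_increasing2)
    next
      case False
      then have "r = r powr (1 - s) * r powr s"
        using that by (simp flip: powr_add)
      also have "\<dots> \<le> l powr (1 - s) * r powr s"
        using False that s by (intro mult_right_mono powr_mono2') auto
      finally show ?thesis using that by linarith
    qed
    with real that show ?thesis
      by (simp add: ennreal_leI flip: ennreal_mult ennreal_plus)
  next
    case top
    with that show ?thesis by (simp add: ennreal_mult_top)
  qed
  have split: "(\<integral>\<^sup>+x\<in>A. u x \<partial>M) \<le> ennreal (l * m) + ennreal (l powr (1 - s)) * B" if l: "0 < l" for l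
  proof -
    have "(\<integral>\<^sup>+x\<in>A. u x \<partial>M)
        \<le> (\<integral>\<^sup>+x. ennreal l * indicator A x
              + ennreal (l powr (1 - s)) * (ennreal_powr (u x) s * indicator A x) \<partial>M)"
      using pt[OF l] by (intro nn_integral_mono) (auto simp: indicator_def)
    also have "\<dots> = ennreal l * emeasure M A + ennreal (l powr (1 - s)) * B"
      by (simp add: nn_integral_add nn_integral_cmult B_def)
    also have "\<dots> \<le> ennreal l * ennreal m + ennreal (l powr (1 - s)) * B"
      using m by (intro add_mono mult_left_mono) auto
    finally show ?thesis using l m by (simp add: ennreal_mult)
  qed
  consider "B = top" | "B = 0" | b where "B = ennreal b" "0 < b"
    by (cases B) (auto simp: less_le)
  then show ?thesis
  proof cases
    case 1
    with m show ?thesis by (simp add: B_def[symmetric] ennreal_mult_top)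
  next
    case 2
    have "(\<integral>\<^sup>+x\<in>A. u x \<partial>M) \<le> 0"
    proof (rule ennreal_le_epsilon)
      fix e :: real assume "0 < e"
      with split[of "e / m"] 2 m show "(\<integral>\<^sup>+x\<in>A. u x \<partial>M) \<le> 0 + ennreal e" by simp
    qed
    then show ?thesis by simp
  next
    case 3
    \<comment> \<open>At this level the two terms of the bound \<open>split\<close> are both equal to \<open>l * m\<close>.\<close>
    define l where "l = (b / m) powr (1 / s)"
    have l: "0 < l" using 3 m by (simp add: l_def)
    have ls: "l powr s = b / m" using s 3 m by (simp add: l_def powr_powr)
    have "l powr (1 - s) * b = l * (b / l powr s)"
      using l by (simp add: powr_diff)
    also have "\<dots> = l * m" using 3 m by (simp add: ls)
    finally have "(\<integral>\<^sup>+x\<in>A. u x \<partial>M) \<le> ennreal (2 * (l * m))"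
      using split[OF l] 3 l m by (simp flip: ennreal_mult ennreal_plus)
    then have "ennreal_powr (\<integral>\<^sup>+x\<in>A. u x \<partial>M) s \<le> ennreal_powr (ennreal (2 * (l * m))) s"
      using s by (intro ennreal_powr_mono) auto
    also have "\<dots> = ennreal ((2 * (l * m)) powr s)"
      using l m by simp
    also have "(2 * (l * m)) powr s = 2 powr s * m powr (s - 1) * b"
      using l m by (simp add: powr_mult ls powr_diff)
    also have "ennreal \<dots> = ennreal (2 powr s * m powr (s - 1)) * B"
      using 3 by (simp add: ennreal_mult)
    finally show ?thesis by (simp add: B_def)
  qed
qed

text \<open>Hoelder's inequality between the exponents \<open>q \<le> p\<close> on a small set: the higher integrability of \<open>u\<close>
is converted into the power \<open>1 - q/p\<close> of the measure of \<open>A\<close>. For finite \<open>p\<close> it is the power mean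
inequality for \<open>u powr q\<close> and the exponent \<open>p / q\<close>.\<close>

lemma set_nn_integral_powr_le_Lp_norm:
  fixes u :: "'a \<Rightarrow> ennreal" and q m :: real
  assumes u [measurable]: "u \<in> borel_measurable M" and A [measurable]: "A \<in> sets M"
    and m: "emeasure M A \<le> ennreal m" "0 < m"
    and q: "0 < q" and p: "0 < p" and pq: "q * enn2real (1 / p) \<le> 1"
  shows "(\<integral>\<^sup>+x\<in>A. ennreal_powr (u x) q \<partial>M)
           \<le> ennreal (2 * m powr (1 - q * enn2real (1 / p))) * ennreal_powr (Lp_norm M p u) q"
proof (cases "p = \<infinity>")
  case True
  have "AE x in M. u x \<le> Lp_norm M p u"
    using True by (simp add: Lp_norm_def esssup_AE)
  then have "(\<integral>\<^sup>+x\<in>A. ennreal_powr (u x) q \<partial>M)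
      \<le> (\<integral>\<^sup>+x\<in>A. ennreal_powr (Lp_norm M p u) q \<partial>M)"
    using q by (intro nn_integral_mono_AE, elim AE_mp) (auto intro!: AE_I2 mult_right_mono ennreal_powr_mono)
  also have "\<dots> = ennreal_powr (Lp_norm M p u) q * emeasure M A"
    by (simp add: nn_integral_cmult)
  also have "\<dots> \<le> ennreal_powr (Lp_norm M p u) q * ennreal (2 * m)"
    using m by (intro mult_left_mono order_trans[OF m(1)] ennreal_leI) auto
  also have "\<dots> = ennreal (2 * m powr (1 - q * enn2real (1 / p))) * ennreal_powr (Lp_norm M p u) q"
    using m True by (simp add: mult.commute)
  finally show ?thesis .
next
  case False
  then obtain r where r: "p = ennreal r" "0 < r"
    using p by (cases p) (auto simp: less_le)
  have rp: "enn2real (1 / p) = 1 / r"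
    using r by (simp add: divide_ennreal_def inverse_ennreal inverse_eq_divide)
  define s where "s = r / q"
  have s: "1 \<le> s" using pq q r(2) unfolding rp by (simp add: s_def field_simps)
  have exponent: "(s - 1) * (1 / s) = 1 - q * (1 / r)" using q r(2) by (simp add: s_def field_simps)
  have qs: "q * s = r" "r * (1 / s) = q" "1 / r * q = 1 / s" using q r by (auto simp: s_def)
  have "ennreal_powr (\<integral>\<^sup>+x\<in>A. ennreal_powr (u x) q \<partial>M) s
      \<le> ennreal (2 powr s * m powr (s - 1)) * (\<integral>\<^sup>+x\<in>A. ennreal_powr (ennreal_powr (u x) q) s \<partial>M)"
    using m s by (intro set_nn_integral_powr_le) auto
  also have "\<dots> \<le> ennreal (2 powr s * m powr (s - 1)) * (\<integral>\<^sup>+x. ennreal_powr (u x) r \<partial>M)"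
    by (intro mult_left_mono nn_integral_mono) (auto simp: ennreal_powr_powr qs indicator_def)
  finally have "ennreal_powr (ennreal_powr (\<integral>\<^sup>+x\<in>A. ennreal_powr (u x) q \<partial>M) s) (1 / s)
      \<le> ennreal_powr (ennreal (2 powr s * m powr (s - 1)) * (\<integral>\<^sup>+x. ennreal_powr (u x) r \<partial>M)) (1 / s)"
    using s by (intro ennreal_powr_mono) auto
  also have "\<dots> = ennreal ((2 powr s * m powr (s - 1)) powr (1 / s))
      * ennreal_powr (\<integral>\<^sup>+x. ennreal_powr (u x) r \<partial>M) (1 / s)"
    using s by (simp add: ennreal_powr_mult)
  also have "(2 powr s * m powr (s - 1)) powr (1 / s) = 2 * m powr (1 - q * enn2real (1 / p))"
    unfolding rp exponent[symmetric] using s by (simp add: powr_mult powr_powr)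
  also have "ennreal_powr (\<integral>\<^sup>+x. ennreal_powr (u x) r \<partial>M) (1 / s) = ennreal_powr (Lp_norm M p u) q"
    using r qs by (simp add: Lp_norm_def ennreal_powr_powr)
  finally show ?thesis using s by (simp add: ennreal_powr_powr)
qed

section \<open>Arcs and Carleson boxes\<close>

text \<open>The measure of a non-measurable set is \<open>0\<close> by convention, so positive length already carries
measurability.\<close>

lemma arc_len_pos_imp_borel:
  assumes "0 < arc_len I"
  shows "I \<in> sets borel"
  using assms by (auto simp: arc_len_def circle_measure_def measure_notin_sets intro: ccontr)

text \<open>An upper bound for the length of an arc in terms of its set of angles \<open>J\<close>. The parameters
\<open>s \<in> {0..<1}\<close> of its points agree with each other modulo integers up to \<open>d / (2 * pi)\<close>,
so they lie in three intervals of length \<open>d / pi\<close>. This loses a factor of six over the sharp bound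
\<open>d / (2 * pi)\<close>, but the constant \<open>3 / pi\<close> is still less than \<open>1\<close>.\<close>

lemma arc_len_image_cis_le:
  fixes J :: "real set"
  assumes d: "0 < d" "d \<le> 1" and J: "\<And>x y. x \<in> J \<Longrightarrow> y \<in> J \<Longrightarrow> \<bar>x - y\<bar> \<le> d"
  shows "arc_len (cis ` J) \<le> 3 * d / pi"
proof (cases "cis ` J \<in> sets borel")
  case False
  then show ?thesis using d by (simp add: arc_len_def circle_measure_def measure_notin_sets)
next
  case True
  define S where "S = {s \<in> {0..<1::real}. cis (2 * pi * s) \<in> cis ` J}"
  have cm: "(\<lambda>s. cis (2 * pi * s)) \<in> restrict_space lborel {0..<1} \<rightarrow>\<^sub>M borel"
    by (intro measurable_restrict_space1)
      (simp, intro borel_measurable_continuous_onI continuous_intros)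
  have meas: "measure circle_measure (cis ` J) = measure lborel S"
  proof -
    have "measure circle_measure (cis ` J)
        = measure (restrict_space lborel {0..<1}) ((\<lambda>s. cis (2 * pi * s)) -` cis ` J \<inter> {0..<1})"
      unfolding circle_measure_def by (subst measure_distr[OF cm True]) (simp add: space_restrict_space)
    also have "(\<lambda>s. cis (2 * pi * s)) -` cis ` J \<inter> {0..<1} = S"
      by (auto simp: S_def)
    finally show ?thesis
      by (subst (asm) measure_restrict_space) (auto simp: S_def)
  qed
  show ?thesis
  proof (cases "S = {}")
    case True
    then show ?thesis using d meas by (simp add: arc_len_def)
  next
    case False
    then obtain s0 where "s0 \<in> S" by auto
    then obtain x0 where x0: "x0 \<in> J" "cis (2 * pi * s0) = cis x0" and s0: "0 \<le> s0" "s0 < 1"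
      by (auto simp: S_def)
    define e where "e = d / (2 * pi)"
    have e: "0 < e" "e < 1" using d pi_gt3 by (auto simp: e_def field_simps)
    define B where "B m = {s0 + of_int m - e..s0 + of_int m + e}" for m :: int
    \<comment> \<open>Two parameters in \<open>{0..<1}\<close> differ by less than \<open>1\<close>, and \<open>e < 1\<close>, so only integers below \<open>2\<close> in modulus can occur.\<close>
    have sub: "S \<subseteq> (\<Union>m\<in>{-1, 0, 1}. B m)"
    proof
      fix s assume "s \<in> S"
      then obtain x where x: "x \<in> J" "cis (2 * pi * s) = cis x" and s: "0 \<le> s" "s < 1"
        by (auto simp: S_def)
      have "cis (2 * pi * (s - s0) - (x - x0)) = 1"
        using x(2) x0(2) by (simp add: cis_divide[symmetric] right_diff_distrib)
      then obtain m :: int where "2 * pi * (s - s0) - (x - x0) = 2 * pi * m"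
        by (auto simp: complex_eq_iff cos_one_2pi_int)
      then have "x - x0 = (s - s0 - m) * (2 * pi)" by (simp add: algebra_simps)
      then have "\<bar>s - s0 - m\<bar> * (2 * pi) = \<bar>x - x0\<bar>" by (simp add: abs_mult)
      also have "\<dots> \<le> d" using J x(1) x0(1) by blast
      finally have *: "\<bar>s - s0 - m\<bar> \<le> e" by (simp add: e_def field_simps)
      with s s0 e have "\<bar>real_of_int m\<bar> < 2" by linarith
      then have "m \<in> {-1, 0, 1}" by auto
      with * show "s \<in> (\<Union>m\<in>{-1, 0, 1}. B m)"
        by (intro UN_I[of m]) (auto simp: B_def abs_le_iff)
    qed
    have "emeasure lborel S \<le> emeasure lborel (\<Union>m\<in>{-1, 0, 1}. B m)"
      using sub by (rule emeasure_mono) (auto simp: B_def)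
    also have "\<dots> \<le> (\<Sum>m\<in>{-1, 0, 1}. emeasure lborel (B m))"
      by (rule emeasure_subadditive_finite) (auto simp: B_def)
    also have "\<dots> = (\<Sum>m\<in>{-1, 0, 1::int}. ennreal (2 * e))"
      using e by (intro sum.cong refl) (simp add: B_def)
    also have "\<dots> = ennreal (\<Sum>m\<in>{-1, 0, 1::int}. 2 * e)"
      using e by (intro sum_ennreal) linarith
    also have "(\<Sum>m\<in>{-1, 0, 1::int}. 2 * e) = 6 * e"
      by (simp only: sum_constant) simp
    also have "\<dots> = 3 * d / pi" by (simp add: e_def)
    finally have "emeasure lborel S \<le> ennreal (3 * d / pi)" .
    then have "measure lborel S \<le> 3 * d / pi"
      using d by (simp add: measure_def enn2real_leI)
    then show ?thesis using meas by (simp add: arc_len_def)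
  qed
qed

text \<open>An arc of length \<open>h\<close> contains all points with angles in some interval of length \<open>h\<close>, as otherwise
the preceding bound would make it shorter than \<open>h\<close>. In polar coordinates the box therefore contains
a rectangle with both sides comparable to \<open>h\<close>. The modulus \<open>1 - h / 2\<close> of its centre is at least
\<open>1/2\<close>, so the box also contains a disc of radius comparable to \<open>h\<close>.\<close>

lemma carleson_box_contains_ball:
  assumes I: "circle_arc I" and h: "arc_len I = h" "0 < h" "h \<le> 1"
  shows "\<exists>c. ball c (h / 16) \<subseteq> carleson_box I"
proof -
  obtain J where J: "is_interval J" "I = cis ` J" using I by (auto simp: circle_arc_def)
  have "\<exists>x\<in>J. \<exists>y\<in>J. x + h < y"
  proof (rule ccontr)
    assume "\<not> ?thesis"
    then have *: "y \<le> x + h" if "x \<in> J" "y \<in> J" for x y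
      using that by (meson not_less)
    have "\<bar>x - y\<bar> \<le> h" if "x \<in> J" "y \<in> J" for x y
      using *[OF that] *[OF that(2,1)] by linarith
    then have "arc_len I \<le> 3 * h / pi"
      using h unfolding J(2) by (intro arc_len_image_cis_le)
    with h pi_gt3 show False by (simp add: field_simps)
  qed
  then obtain x y where xy: "x \<in> J" "y \<in> J" "x + h < y"
    by blast
  define a where "a = (x + y) / 2"
  have inJ: "a + s \<in> J" if "\<bar>s\<bar> \<le> h / 2" for s
  proof -
    have "x \<le> a + s" "a + s \<le> y" using that xy(3) by (auto simp: a_def field_simps abs_le_iff)
    with J(1) xy(1,2) show ?thesis unfolding is_interval_1 by blast
  qed
  \<comment> \<open>The disc is centred in the middle of the box; rotating by \<open>- a\<close> moves its centre to the positive axis.\<close>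
  define r where "r = 1 - h / 2"
  have "ball (of_real r * cis a) (h / 16) \<subseteq> carleson_box I"
  proof
    fix w assume "w \<in> ball (of_real r * cis a) (h / 16)"
    then have w: "cmod (w - of_real r * cis a) < h / 16"
      by (simp add: dist_norm norm_minus_commute)
    define u where "u = w * cis (- a)"
    have "u - of_real r = (w - of_real r * cis a) * cis (- a)"
      by (simp add: u_def algebra_simps cis_mult)
    then have u: "cmod (u - of_real r) < h / 16" using w by (simp add: norm_mult)
    have nu: "cmod u = cmod w" by (simp add: u_def norm_mult)
    have "\<bar>cmod u - cmod (of_real r)\<bar> < h / 16"
      using u norm_triangle_ineq3[of u "of_real r"] by linarith
    moreover have "0 \<le> r" using h by (simp add: r_def)
    ultimately have "\<bar>cmod w - r\<bar> < h / 16" by (simp add: nu)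
    then have cw: "1 - h \<le> cmod w" "cmod w < 1" "0 < cmod w"
      using h(2,3) unfolding r_def by linarith+
    have im: "\<bar>Im u\<bar> < h / 16" and "\<bar>Re u - r\<bar> < h / 16"
      using u abs_Im_le_cmod[of "u - of_real r"] abs_Re_le_cmod[of "u - of_real r"] by auto
    then have re: "7 / 16 < Re u" using h(2,3) unfolding r_def by linarith
    \<comment> \<open>The angle of \<open>w\<close> relative to the centre. The radius \<open>h / 16\<close> keeps it at most \<open>h / 7\<close>.\<close>
    define b where "b = arctan (Im u / Re u)"
    have "\<bar>b\<bar> \<le> \<bar>Im u / Re u\<bar>" unfolding b_def by (rule abs_arctan_le)
    also have "\<dots> = \<bar>Im u\<bar> / Re u" using re by (simp add: abs_divide)
    also have "\<dots> \<le> (h / 16) / (7 / 16)" using im re h by (intro frac_le) auto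
    also have "\<dots> \<le> h / 2" using h by simp
    finally have "a + b \<in> J" by (rule inJ)
    moreover have "w / of_real (cmod w) = cis (a + b)"
    proof -
      have "b = Arg u" using re unfolding b_def by (simp add: arg_conv_arctan)
      then have "u = of_real (cmod u) * cis b"
        by (metis rcis_cmod_Arg rcis_def)
      moreover have "w = u * cis a" by (simp add: u_def cis_mult)
      ultimately have "w = of_real (cmod w) * cis b * cis a" by (simp only: nu)
      then have "w = of_real (cmod w) * cis (a + b)"
        by (simp only: mult.assoc cis_mult add.commute[of b])
      then show ?thesis using cw(3) by (metis nonzero_mult_div_cancel_left of_real_eq_0_iff less_irrefl)
    qed
    ultimately show "w \<in> carleson_box I"
      using cw h J by (auto simp: carleson_box_def)
  qed
  then show ?thesis by blast
qed

section \<open>Areas of boxes and annuli\<close>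

lemma space_disc_measure: "space disc_measure = ball 0 1"
  by (simp add: disc_measure_def space_scale_measure space_restrict_space)

lemma sets_disc_measure: "A \<in> sets disc_measure \<longleftrightarrow> A \<in> sets lebesgue \<and> A \<subseteq> ball 0 1"
  by (auto simp: disc_measure_def sets_restrict_space)

lemma emeasure_disc_measure:
  assumes "A \<in> sets lebesgue" "A \<subseteq> ball 0 1"
  shows "emeasure disc_measure A = ennreal (1 / pi) * emeasure lebesgue A"
  using assms by (simp add: disc_measure_def emeasure_restrict_space)

lemma emeasure_disc_measure_ball:
  assumes "ball c r \<subseteq> ball 0 1" "0 \<le> r"
  shows "emeasure disc_measure (ball c r) = ennreal (r ^ 2)"
proof -
  have "emeasure lebesgue (ball c r) = ennreal (pi * r ^ 2)"
    using assms(2) by (simp add: emeasure_ball unit_ball_vol_2)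
  then show ?thesis
    using assms by (simp add: emeasure_disc_measure flip: ennreal_mult)
qed

lemma finite_measure_disc_measure: "finite_measure disc_measure"
  using emeasure_disc_measure_ball[of 0 1]
  by (intro finite_measureI) (simp add: space_disc_measure)

text \<open>All boxes of arcs of length \<open>h\<close> lie in the boundary annulus of width \<open>h\<close>, whose measure is only
linear in \<open>h\<close>.\<close>

lemma emeasure_disc_measure_annulus:
  assumes "0 \<le> h" "h \<le> 1"
  shows "emeasure disc_measure {z \<in> ball 0 1. 1 - h \<le> cmod z} \<le> ennreal (2 * h)"
proof -
  have eq: "{z \<in> ball 0 1. 1 - h \<le> cmod z} = ball 0 1 - ball 0 (1 - h)" by auto
  have "emeasure disc_measure (ball 0 1 - ball 0 (1 - h))
      = emeasure disc_measure (ball 0 1) - emeasure disc_measure (ball 0 (1 - h))"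
    using assms by (intro emeasure_Diff) (auto simp: sets_disc_measure emeasure_disc_measure_ball subset_ball)
  also have "\<dots> = ennreal (1 - (1 - h)\<^sup>2)"
    using assms by (simp add: emeasure_disc_measure_ball subset_ball ennreal_minus flip: ennreal_1)
  also have "\<dots> \<le> ennreal (2 * h)"
    by (intro ennreal_leI) (simp add: power2_eq_square algebra_simps)
  finally show ?thesis unfolding eq .
qed

lemma sets_carleson_box:
  assumes "I \<in> sets borel"
  shows "carleson_box I \<in> sets disc_measure"
proof -
  have "carleson_box I = {z \<in> space borel. z / of_real (cmod z) \<in> I \<and> 1 - arc_len I \<le> cmod z \<and> cmod z < 1}"
    by (auto simp: carleson_box_def)
  also have "\<dots> \<in> sets borel" using assms by measurable
  finally show ?thesis by (auto simp: sets_disc_measure carleson_box_def)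
qed

text \<open>This turns the negative powers of the area of a box into powers of \<open>h\<^sup>2\<close>.\<close>

lemma measure_carleson_box_ge:
  assumes I: "circle_arc I" and h: "arc_len I = h" "0 < h" "h \<le> 1"
  shows "h\<^sup>2 / 256 \<le> measure disc_measure (carleson_box I)"
proof -
  interpret finite_measure disc_measure by (rule finite_measure_disc_measure)
  obtain c where c: "ball c (h / 16) \<subseteq> carleson_box I"
    using carleson_box_contains_ball[OF assms] by blast
  have sub: "ball c (h / 16) \<subseteq> ball 0 1"
    using c by (auto simp: carleson_box_def)
  have "h\<^sup>2 / 256 = measure disc_measure (ball c (h / 16))"
    using emeasure_disc_measure_ball[OF sub] h by (simp add: measure_def power_divide)
  also have "\<dots> \<le> measure disc_measure (carleson_box I)"
    using c h by (intro finite_measure_mono sets_carleson_box arc_len_pos_imp_borel) auto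
  finally show ?thesis .
qed

section \<open>The dyadic hypersingular maximal operator\<close>

text \<open>The quotient whose supremum over the boxes containing a point is the maximal function. For \<open>t = 1\<close>
it is the mean of \<open>u\<close> over the box.\<close>

definition box_quotient :: "real \<Rightarrow> (complex \<Rightarrow> ennreal) \<Rightarrow> complex set \<Rightarrow> ennreal" where
  "box_quotient t u I = (\<integral>\<^sup>+w\<in>carleson_box I. u w \<partial>disc_measure)
     / ennreal (measure disc_measure (carleson_box I) powr t)"

text \<open>Here the index set of the supremum is the same for all points, which gives measurability because a
dyadic system is countable.\<close>

lemma dyadic_maximal_eq_SUP_indicator:
  "dyadic_maximal t \<D> f z =
     (SUP I\<in>\<D>. box_quotient t (\<lambda>w. ennreal (cmod (f w))) I * indicator (carleson_box I) z)"
  unfolding dyadic_maximal_def box_quotient_def[symmetric]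
proof (rule antisym)
  show "(SUP I\<in>{I \<in> \<D>. z \<in> carleson_box I}. box_quotient t (\<lambda>w. ennreal (cmod (f w))) I)
    \<le> (SUP I\<in>\<D>. box_quotient t (\<lambda>w. ennreal (cmod (f w))) I * indicator (carleson_box I) z)"
    by (rule SUP_mono) (auto intro!: bexI)
  show "(SUP I\<in>\<D>. box_quotient t (\<lambda>w. ennreal (cmod (f w))) I * indicator (carleson_box I) z)
    \<le> (SUP I\<in>{I \<in> \<D>. z \<in> carleson_box I}. box_quotient t (\<lambda>w. ennreal (cmod (f w))) I)"
    by (rule SUP_least) (auto simp: indicator_def intro: SUP_upper)
qed

text \<open>By the power mean inequality the contribution of one box \<open>Q\<close> is at most a multiple of
\<open>|Q| powr (q - 1 - t * q + 1)\<close> times the integral of \<open>u powr q\<close> over \<open>Q\<close>. The exponent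
\<open>q * (1 - t)\<close> is not positive, so the lower bound for \<open>|Q|\<close> applies.\<close>

lemma box_quotient_powr_le:
  assumes I: "circle_arc I" and h: "arc_len I = h" "0 < h" "h \<le> 1"
    and u [measurable]: "u \<in> borel_measurable disc_measure" and q: "1 \<le> q" and t: "1 \<le> t"
  shows "ennreal_powr (box_quotient t u I) q * emeasure disc_measure (carleson_box I)
    \<le> ennreal (2 powr q * (h\<^sup>2 / 256) powr (q * (1 - t)))
        * (\<integral>\<^sup>+w\<in>carleson_box I. ennreal_powr (u w) q \<partial>disc_measure)"
proof -
  interpret finite_measure disc_measure by (rule finite_measure_disc_measure)
  define Q where "Q = carleson_box I"
  define m where "m = measure disc_measure Q"
  have [measurable]: "Q \<in> sets disc_measure"
    unfolding Q_def using h by (intro sets_carleson_box arc_len_pos_imp_borel) auto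
  have em: "emeasure disc_measure Q = ennreal m" by (simp add: m_def emeasure_eq_measure)
  have mh: "h\<^sup>2 / 256 \<le> m" unfolding m_def Q_def by (rule measure_carleson_box_ge[OF I h])
  then have m: "0 < m" using h by (smt (verit) zero_less_power divide_pos_pos)
  have "box_quotient t u I = (\<integral>\<^sup>+w\<in>Q. u w \<partial>disc_measure) * ennreal (m powr (- t))"
    using m by (simp add: box_quotient_def Q_def m_def divide_ennreal_def inverse_ennreal powr_minus)
  then have "ennreal_powr (box_quotient t u I) q
      = ennreal_powr (\<integral>\<^sup>+w\<in>Q. u w \<partial>disc_measure) q * ennreal (m powr (- t * q))"
    using q by (simp add: ennreal_powr_mult powr_powr)
  also have "\<dots> \<le> (ennreal (2 powr q * m powr (q - 1)) * (\<integral>\<^sup>+w\<in>Q. ennreal_powr (u w) q \<partial>disc_measure))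
      * ennreal (m powr (- t * q))"
    using m em q by (intro mult_right_mono set_nn_integral_powr_le) auto
  finally have "ennreal_powr (box_quotient t u I) q * emeasure disc_measure Q
      \<le> (ennreal (2 powr q * m powr (q - 1)) * (\<integral>\<^sup>+w\<in>Q. ennreal_powr (u w) q \<partial>disc_measure))
      * ennreal (m powr (- t * q)) * emeasure disc_measure Q"
    by (rule mult_right_mono) simp
  also have "\<dots> = ennreal (2 powr q * m powr (q - 1) * m powr (- t * q) * m)
      * (\<integral>\<^sup>+w\<in>Q. ennreal_powr (u w) q \<partial>disc_measure)"
    using m by (simp add: em ennreal_mult mult_ac)
  also have "2 powr q * m powr (q - 1) * m powr (- t * q) * m = 2 powr q * m powr (q * (1 - t))"
  proof -
    have "m powr (q - 1) * m powr (- t * q) * m powr 1 = m powr (q * (1 - t))"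
      unfolding powr_add[symmetric] by (simp add: algebra_simps)
    with m show ?thesis by (simp add: mult.assoc)
  qed
  also have "ennreal (2 powr q * m powr (q * (1 - t))) * (\<integral>\<^sup>+w\<in>Q. ennreal_powr (u w) q \<partial>disc_measure)
      \<le> ennreal (2 powr q * (h\<^sup>2 / 256) powr (q * (1 - t))) * (\<integral>\<^sup>+w\<in>Q. ennreal_powr (u w) q \<partial>disc_measure)"
    using mh h q t
    by (intro mult_right_mono ennreal_leI mult_left_mono powr_mono2') (auto simp: mult_nonneg_nonpos)
  finally show ?thesis by (simp add: Q_def)
qed

text \<open>The boxes of disjoint arcs of equal length are disjoint and lie in a common annulus.\<close>

lemma sum_set_nn_integral_carleson_box_le:
  assumes G: "finite G" "disjoint G" and h: "\<And>I. I \<in> G \<Longrightarrow> arc_len I = h" "0 < h"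
    and g [measurable]: "g \<in> borel_measurable disc_measure"
  shows "(\<Sum>I\<in>G. \<integral>\<^sup>+w\<in>carleson_box I. g w \<partial>disc_measure)
    \<le> (\<integral>\<^sup>+w\<in>{z \<in> ball 0 1. 1 - h \<le> cmod z}. g w \<partial>disc_measure)"
proof -
  have [measurable]: "carleson_box I \<in> sets disc_measure" if "I \<in> G" for I
    using h that by (intro sets_carleson_box arc_len_pos_imp_borel) auto
  have disj: "disjoint_family_on carleson_box G"
    using G(2) by (auto simp: disjoint_family_on_def carleson_box_def disjoint_def)
  have "(\<Sum>I\<in>G. \<integral>\<^sup>+w\<in>carleson_box I. g w \<partial>disc_measure)
      = (\<integral>\<^sup>+w. (\<Sum>I\<in>G. g w * indicator (carleson_box I) w) \<partial>disc_measure)"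
    by (intro nn_integral_sum[symmetric]) auto
  also have "\<dots> = (\<integral>\<^sup>+w\<in>\<Union>(carleson_box ` G). g w \<partial>disc_measure)"
    using G(1) disj by (simp add: indicator_UN_disjoint sum_distrib_left)
  also have "\<dots> \<le> (\<integral>\<^sup>+w\<in>{z \<in> ball 0 1. 1 - h \<le> cmod z}. g w \<partial>disc_measure)"
    using h by (intro nn_set_integral_set_mono) (auto simp: carleson_box_def)
  finally show ?thesis .
qed

text \<open>The contribution of one generation. Up to constants it is \<open>h powr (2 * q * (1 - t) + 1 - q/p)\<close>,
where the first summand is the singularity of the operator and the rest is the gain from the small
area of the annulus.\<close>

lemma sum_box_quotient_powr_le:
  assumes G: "finite G" "disjoint G" and I: "\<And>I. I \<in> G \<Longrightarrow> circle_arc I \<and> arc_len I = h"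
    and h: "0 < h" "h \<le> 1"
    and u [measurable]: "u \<in> borel_measurable disc_measure" and q: "1 \<le> q" and t: "1 \<le> t"
    and p: "0 < p" "q * enn2real (1 / p) \<le> 1"
  shows "(\<Sum>I\<in>G. ennreal_powr (box_quotient t u I) q * emeasure disc_measure (carleson_box I))
    \<le> ennreal (2 powr q * (h\<^sup>2 / 256) powr (q * (1 - t)) * (2 * (2 * h) powr (1 - q * enn2real (1 / p))))
        * ennreal_powr (Lp_norm disc_measure p u) q"
proof -
  define A where "A = {z::complex. z \<in> ball 0 1 \<and> 1 - h \<le> cmod z}"
  let ?c = "2 powr q * (h\<^sup>2 / 256) powr (q * (1 - t))"
  let ?d = "2 * (2 * h) powr (1 - q * enn2real (1 / p))"
  have A: "A \<in> sets disc_measure"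
  proof -
    have "A = ball 0 1 - ball 0 (1 - h)" by (auto simp: A_def)
    then show ?thesis by (auto simp: sets_disc_measure)
  qed
  have "(\<Sum>I\<in>G. ennreal_powr (box_quotient t u I) q * emeasure disc_measure (carleson_box I))
      \<le> (\<Sum>I\<in>G. ennreal ?c * (\<integral>\<^sup>+w\<in>carleson_box I. ennreal_powr (u w) q \<partial>disc_measure))"
    using I h q t by (intro sum_mono box_quotient_powr_le) auto
  also have "\<dots> = ennreal ?c * (\<Sum>I\<in>G. \<integral>\<^sup>+w\<in>carleson_box I. ennreal_powr (u w) q \<partial>disc_measure)"
    by (simp add: sum_distrib_left)
  also have "\<dots> \<le> ennreal ?c * (\<integral>\<^sup>+w\<in>A. ennreal_powr (u w) q \<partial>disc_measure)"
    using G I h unfolding A_def by (intro mult_left_mono sum_set_nn_integral_carleson_box_le) auto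
  also have "\<dots> \<le> ennreal ?c * (ennreal ?d * ennreal_powr (Lp_norm disc_measure p u) q)"
    using h p q A emeasure_disc_measure_annulus[of h, folded A_def]
    by (intro mult_left_mono set_nn_integral_powr_le_Lp_norm) auto
  also have "\<dots> = ennreal (?c * ?d) * ennreal_powr (Lp_norm disc_measure p u) q"
    by (subst ennreal_mult) (auto simp: mult.assoc)
  finally show ?thesis .
qed

text \<open>The power \<open>q\<close> of a supremum is at most the sum of the powers \<open>q\<close> of its terms. Since the
contributions of the generations decay geometrically, this crude bound costs only a constant.\<close>

lemma dyadic_maximal_powr_le_suminf:
  assumes G: "\<And>k. finite (G k)" and D: "\<D> = (\<Union>k. G k)" and q: "0 < q"
  shows "ennreal_powr (dyadic_maximal t \<D> f z) q
    \<le> (\<Sum>k. \<Sum>I\<in>G k. ennreal_powr (box_quotient t (\<lambda>w. ennreal (cmod (f w))) I) q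
             * indicator (carleson_box I) z)"
    (is "_ \<le> suminf ?S")
proof -
  let ?a = "box_quotient t (\<lambda>w. ennreal (cmod (f w)))"
  have "dyadic_maximal t \<D> f z \<le> ennreal_powr (suminf ?S) (1 / q)"
    unfolding dyadic_maximal_def box_quotient_def[symmetric]
  proof (rule SUP_least)
    fix I assume "I \<in> {I \<in> \<D>. z \<in> carleson_box I}"
    then obtain k where k: "I \<in> G k" and z: "z \<in> carleson_box I" by (auto simp: D)
    have "ennreal_powr (?a I) q = ennreal_powr (?a I) q * indicator (carleson_box I) z"
      using z by simp
    also have "\<dots> \<le> ?S k"
      using k G by (intro member_le_sum) auto
    also have "\<dots> \<le> suminf ?S"
      using sum_le_suminf[of ?S "{k}"] by simp
    finally have "ennreal_powr (ennreal_powr (?a I) q) (1 / q) \<le> ennreal_powr (suminf ?S) (1 / q)"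
      using q by (intro ennreal_powr_mono) auto
    then show "?a I \<le> ennreal_powr (suminf ?S) (1 / q)"
      using q by (simp add: ennreal_powr_powr)
  qed
  then have "ennreal_powr (dyadic_maximal t \<D> f z) q
      \<le> ennreal_powr (ennreal_powr (suminf ?S) (1 / q)) q"
    using q by (intro ennreal_powr_mono) auto
  then show ?thesis using q by (simp add: ennreal_powr_powr)
qed

text \<open>The constants of the generations form a geometric progression in \<open>k\<close>; with \<open>e = 1 - q/p\<close> its ratio
is less than \<open>1\<close> exactly when \<open>1/q - 1/p > 2 * t - 2\<close>.\<close>

lemma level_constant_geometric:
  fixes q t e :: real and k :: nat
  defines "h \<equiv> 1 / 2 ^ k"
  shows "2 powr q * (h\<^sup>2 / 256) powr (q * (1 - t)) * (2 * (2 * h) powr e)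
    = 2 powr (q + 8 * (q * (t - 1)) + 1 + e) * (2 powr (q * (2 * t - 2) - e)) ^ k"
proof -
  have h: "h = 2 powr (- real k)"
    by (simp add: h_def powr_minus powr_realpow divide_inverse)
  have "(256::real) = 2 powr 8" by simp
  then have "h\<^sup>2 / 256 = 2 powr (- 2 * real k - 8)"
    unfolding h by (simp add: power2_eq_square powr_diff flip: powr_add)
  moreover have "2 * h = 2 powr (1 - real k)"
    unfolding h by (simp add: powr_diff powr_minus divide_inverse)
  moreover have "(2 powr (q * (2 * t - 2) - e)) ^ k = 2 powr ((q * (2 * t - 2) - e) * k)"
    by (simp add: powr_powr flip: powr_realpow)
  ultimately have "2 powr q * (h\<^sup>2 / 256) powr (q * (1 - t)) * (2 * (2 * h) powr e)
    = 2 powr q * 2 powr ((- 2 * real k - 8) * (q * (1 - t))) * (2 powr 1 * 2 powr ((1 - real k) * e))"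
    by (simp add: powr_powr)
  also have "\<dots> = 2 powr (q + 8 * (q * (t - 1)) + 1 + e) * 2 powr ((q * (2 * t - 2) - e) * k)"
    unfolding powr_add[symmetric] by (rule arg_cong[of _ _ "(powr) 2"]) (simp add: algebra_simps)
  also have "2 powr ((q * (2 * t - 2) - e) * k) = (2 powr (q * (2 * t - 2) - e)) ^ k"
    by (simp add: powr_powr flip: powr_realpow)
  finally show ?thesis .
qed

theorem proposition3p3:
  fixes t :: real and \<D> :: "complex set set" and p q :: ennreal
  assumes "1 < t" and "t < 3 / 2"
    and "dyadic_system \<D>"
    and "1 / p \<in> {0..1}" and "1 / q \<in> {0..1}"
    and "enn2real (1 / q) - enn2real (1 / p) > 2 * t - 2"
  shows "bounded_Lp_Lq disc_measure p q (dyadic_maximal t \<D>)"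
proof -
  obtain G where D: "\<D> = (\<Union>k. G k)"
    and G: "\<And>k. card (G k) = 2 ^ k" "\<And>k. disjoint (G k)"
      "\<And>k I. I \<in> G k \<Longrightarrow> circle_arc I \<and> arc_len I = 1 / 2 ^ k"
    using assms(3) unfolding dyadic_system_def by metis
  have fin: "finite (G k)" for k
    using G(1)[of k] by (intro card_ge_0_finite) simp
  have box [measurable]: "carleson_box I \<in> sets disc_measure" if "I \<in> G k" for I k
    using G(3)[OF that] by (intro sets_carleson_box arc_len_pos_imp_borel) auto
  have p: "0 < p"
    using assms(4) by (auto simp: zero_less_iff_neq_zero top_unique)
  have "enn2real (1 / q) > 0"
    using assms(1,6) enn2real_nonneg[of "1 / p"] by linarith
  \<comment> \<open>Since \<open>1 / 0 = \<infinity>\<close> and \<open>enn2real \<infinity> = 0\<close>, positivity excludes \<open>q = 0\<close> as well as \<open>q = \<infinity>\<close>.\<close>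
  then have "q \<noteq> 0" "q \<noteq> top" by auto
  then obtain r where r: "q = ennreal r" "0 < r"
    by (cases q) (auto simp: less_le)
  have rq: "enn2real (1 / q) = 1 / r"
    using r by (simp add: divide_ennreal_def inverse_ennreal inverse_eq_divide)
  have "ennreal (1 / r) \<le> 1"
    using assms(5) r by (simp add: divide_ennreal_def inverse_ennreal inverse_eq_divide)
  then have r1: "1 \<le> r" using r by simp
  define e where "e = 1 - r * enn2real (1 / p)"
  have e: "r * (2 * t - 2) < e"
    using assms(6) r(2) unfolding rq e_def by (simp add: field_simps)
  have "0 < r * (2 * t - 2)" using r assms(1) by simp
  with e have pr: "r * enn2real (1 / p) \<le> 1" by (simp add: e_def)
  define \<rho> where "\<rho> = 2 powr (r * (2 * t - 2) - e)"
  have \<rho>: "0 \<le> \<rho>" "\<rho> < 1" using e by (auto simp: \<rho>_def powr_less_one)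
  define K where "K = 2 powr (r + 8 * (r * (t - 1)) + 1 + e)"
  have K: "0 \<le> K" by (simp add: K_def)
  show ?thesis
    unfolding bounded_Lp_Lq_def
  proof (intro exI ballI conjI)
    fix f assume f: "f \<in> Lp_space disc_measure p"
    then have [measurable]: "f \<in> borel_measurable disc_measure" by (simp add: Lp_space_def)
    define u where "u w = ennreal (cmod (f w))" for w
    have [measurable]: "u \<in> borel_measurable disc_measure" unfolding u_def by measurable
    show meas: "dyadic_maximal t \<D> f \<in> borel_measurable disc_measure"
    proof -
      have "countable \<D>" using fin by (auto simp: D intro: countable_finite)
      then have "(\<lambda>z. SUP I\<in>\<D>. box_quotient t u I * indicator (carleson_box I) z)
          \<in> borel_measurable disc_measure"
        using box by (intro borel_measurable_SUP) (auto simp: D)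
      then show ?thesis
        unfolding u_def dyadic_maximal_eq_SUP_indicator[symmetric] .
    qed
    let ?N = "ennreal_powr (Lp_norm disc_measure p u) r"
    have "(\<integral>\<^sup>+z. ennreal_powr (dyadic_maximal t \<D> f z) r \<partial>disc_measure)
        \<le> (\<integral>\<^sup>+z. (\<Sum>k. \<Sum>I\<in>G k. ennreal_powr (box_quotient t u I) r * indicator (carleson_box I) z) \<partial>disc_measure)"
      unfolding u_def using fin D r(2) by (intro nn_integral_mono dyadic_maximal_powr_le_suminf)
    also have "\<dots> = (\<Sum>k. \<Sum>I\<in>G k. ennreal_powr (box_quotient t u I) r * emeasure disc_measure (carleson_box I))"
    proof (subst nn_integral_suminf)
      fix k
      show "(\<lambda>z. \<Sum>I\<in>G k. ennreal_powr (box_quotient t u I) r * indicator (carleson_box I) z)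
          \<in> borel_measurable disc_measure"
        using box by (intro borel_measurable_sum) auto
    next
      show "(\<Sum>k. \<integral>\<^sup>+z. (\<Sum>I\<in>G k. ennreal_powr (box_quotient t u I) r * indicator (carleson_box I) z) \<partial>disc_measure)
        = (\<Sum>k. \<Sum>I\<in>G k. ennreal_powr (box_quotient t u I) r * emeasure disc_measure (carleson_box I))"
        using box by (intro suminf_cong, subst nn_integral_sum)
          (auto intro!: sum.cong nn_integral_cmult_indicator)
    qed
    also have "\<dots> \<le> (\<Sum>k. ennreal (K * \<rho> ^ k) * ?N)"
    proof (intro suminf_le summableI)
      fix k
      have "(\<Sum>I\<in>G k. ennreal_powr (box_quotient t u I) r * emeasure disc_measure (carleson_box I))
        \<le> ennreal (2 powr r * ((1 / 2 ^ k)\<^sup>2 / 256) powr (r * (1 - t)) * (2 * (2 * (1 / 2 ^ k)) powr e)) * ?N"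
        unfolding e_def using fin G r1 p pr assms(1)
        by (intro sum_box_quotient_powr_le) auto
      then show "(\<Sum>I\<in>G k. ennreal_powr (box_quotient t u I) r * emeasure disc_measure (carleson_box I))
        \<le> ennreal (K * \<rho> ^ k) * ?N"
        unfolding level_constant_geometric K_def \<rho>_def .
    qed
    also have "\<dots> = (\<Sum>k. ennreal (K * \<rho> ^ k)) * ?N"
      by simp
    also have "(\<Sum>k. ennreal (K * \<rho> ^ k)) = ennreal (K * (1 / (1 - \<rho>)))"
    proof (rule suminf_ennreal_eq)
      show "(\<lambda>k. K * \<rho> ^ k) sums (K * (1 / (1 - \<rho>)))"
        using \<rho> by (intro sums_mult geometric_sums) auto
    qed (use K \<rho> in auto)
    finally have "ennreal_powr (\<integral>\<^sup>+z. ennreal_powr (dyadic_maximal t \<D> f z) r \<partial>disc_measure) (1 / r)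
        \<le> ennreal_powr (ennreal (K * (1 / (1 - \<rho>))) * ?N) (1 / r)"
      using r by (intro ennreal_powr_mono) auto
    also have "\<dots> = ennreal ((K * (1 / (1 - \<rho>))) powr (1 / r)) * Lp_norm disc_measure p u"
      using r K \<rho> by (simp add: ennreal_powr_mult ennreal_powr_powr)
    finally show "Lp_norm disc_measure q (dyadic_maximal t \<D> f)
        \<le> ennreal ((K * (1 / (1 - \<rho>))) powr (1 / r)) * Lp_norm disc_measure p (\<lambda>x. ennreal (cmod (f x)))"
      using r unfolding u_def[abs_def] by (subst (1) Lp_norm_def) simp
  qed
qed

end
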